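(* Let $X$ be a real Banach space, let $P:X\to\mathbb{R}$ be a continuous 2-homogeneous polynomial, and suppose that there is a $P$-maximal subspace $M$ of $X$ of finite dimension $k$. If $H\subset X$ is an $m$-dimensional subspace such that $P|_H=0$, then $m\le k$.
   Context: A continuous 2-homogeneous polynomial on a real Banach space $X$ is a map $P:X\to\mathbb{R}$ of the form $P(x)=\overset{\vee}{P}(x,x)$ with $\overset{\vee}{P}:X\times X\to\mathbb{R}$ symmetric bilinear, such that $|P(x)|\le C\|x\|^2$ for some constant $C$ and all $x\in X$. For a non-zero such $P$, a linear subspace $M\subsetneqq X$ is called $P$-maximal if $P|_M=0$ and whenever $M_1$ is a linear subspace with $M\subset M_1\subset X$ and $P|_{M_1}=0$, then $M_1=M$. *)

theory Defs
  imports "HOL-Analysis.Analysis"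
begin

definition continuous_quadratic :: "('a::real_normed_vector \<Rightarrow> real) \<Rightarrow> bool" where
  "continuous_quadratic P \<longleftrightarrow>
     (\<exists>A. bilinear A \<and> (\<forall>x y. A x y = A y x) \<and> (\<forall>x. P x = A x x)) \<and>
     (\<exists>C. \<forall>x. \<bar>P x\<bar> \<le> C * (norm x)\<^sup>2)"

definition P_maximal :: "('a::real_vector \<Rightarrow> real) \<Rightarrow> 'a set \<Rightarrow> bool" where
  "P_maximal P M \<longleftrightarrow>
     (\<exists>x. P x \<noteq> 0) \<and> subspace M \<and> M \<noteq> UNIV \<and> (\<forall>x\<in>M. P x = 0) \<and>
     (\<forall>M1. subspace M1 \<and> M \<subseteq> M1 \<and> (\<forall>x\<in>M1. P x = 0) \<longrightarrow> M1 = M)"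

(* The finite spanning set cannot be dropped: dim is a natural number and is 0 on
   infinite-dimensional subspaces. *)
definition subspace_of_dim :: "'a::real_vector set \<Rightarrow> nat \<Rightarrow> bool" where
  "subspace_of_dim S n \<longleftrightarrow> subspace S \<and> (\<exists>B. finite B \<and> span B = S) \<and> dim S = n"

end

theory Submission
  imports Defs
begin

text \<open>
  Let \<open>A\<close> be the symmetric bilinear form of \<open>P\<close>; by polarization \<open>A\<close> vanishes on \<open>N \<times> N\<close>
  whenever \<open>N\<close> is a subspace on which \<open>P\<close> is zero. Maximality of \<open>M\<close> says that every zero \<open>x\<close> of
  \<open>P\<close> that is \<open>A\<close>-orthogonal to \<open>M\<close> lies in \<open>M\<close>, because otherwise \<open>M + \<real>x\<close> would be a
  strictly larger subspace of zeros (lemma \<open>orthogonal_isotropic_in_maximal\<close>).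

  Pair \<open>H\<close> with \<open>M\<close> through \<open>A\<close>. An element of \<open>H\<close> orthogonal to \<open>M\<close> is a zero of \<open>P\<close>, hence
  lies in \<open>H \<inter> M\<close>. An element of \<open>H \<inter> M\<close> is orthogonal to all of \<open>H\<close>, because \<open>H\<close> is isotropic.
  Hence \<open>h \<mapsto> A h \<cdot>\<close> embeds \<open>H / (H \<inter> M)\<close> into the dual of \<open>M / (H \<inter> M)\<close>, and
  \<open>dim H - dim (H \<inter> M) \<le> dim M - dim (H \<inter> M)\<close> (lemma \<open>dim_le_if_pairing_separates\<close>).
\<close>

lemma span_disjoint_subsets_of_independent:
  fixes B :: "'a::real_vector set"
  assumes "independent B" "S \<subseteq> B" "T \<subseteq> B" "S \<inter> T = {}" "x \<in> span S" "x \<in> span T"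
  shows "x = 0"
proof -
  have S: "independent S" and T: "independent T"
    using assms independent_mono by blast+
  have "representation S x = representation B x" "representation T x = representation B x"
    using representation_extend[OF assms(1,5,2)] representation_extend[OF assms(1,6,3)] by simp_all
  then have "representation S x b = 0" for b
    using representation_ne_zero[of S x b] representation_ne_zero[of T x b] assms(4) by auto
  then show "x = 0"
    using sum_nonzero_representation_eq[OF S assms(5)] by simp
qed

text \<open>
  The form induces an injection of \<open>H / (H \<inter> M)\<close> into the dual of \<open>M / (H \<inter> M)\<close>. Both quotients are
  realised inside the ambient space by completing one basis of \<open>H \<inter> M\<close> to bases of \<open>H\<close> and of \<open>M\<close>,
  and the dual of the complement in \<open>M\<close> is identified with the complement by means of its basis.
\<close>

lemma dim_le_if_pairing_separates:
  fixes A :: "'a::real_vector \<Rightarrow> 'a \<Rightarrow> real"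
  assumes A: "bilinear A"
    and H: "subspace H" and M: "subspace M"
    and finite_H: "finite F" "H \<subseteq> span F" and finite_M: "finite G" "M \<subseteq> span G"
    and radical: "\<And>x y. x \<in> H \<Longrightarrow> y \<in> H \<inter> M \<Longrightarrow> A x y = 0"
    and separates: "\<And>x. x \<in> H \<Longrightarrow> (\<And>y. y \<in> M \<Longrightarrow> A x y = 0) \<Longrightarrow> x \<in> M"
  shows "dim H \<le> dim M"
proof -
  obtain D where D: "D \<subseteq> H \<inter> M" "independent D" "H \<inter> M \<subseteq> span D"
    by (meson basis_exists)
  obtain E where E: "D \<subseteq> E" "E \<subseteq> H" "independent E" "H \<subseteq> span E"
    using maximal_independent_subset_extend[of D H] D by auto
  obtain C where C: "D \<subseteq> C" "C \<subseteq> M" "independent C" "M \<subseteq> span C"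
    using maximal_independent_subset_extend[of D M] D by auto
  have fin: "finite E" "finite C"
    using independent_span_bound[OF finite_H(1) E(3)] independent_span_bound[OF finite_M(1) C(3)]
      E(2) C(2) finite_H(2) finite_M(2) by auto
  have linear_A: "linear (\<lambda>x. A x y)" "linear (A x)" for x y
    using A by (simp_all add: bilinear_def)
  \<comment> \<open>\<open>T x\<close> encodes the functional \<open>A x\<close> restricted to the span of \<open>C - D\<close> by its values on that basis.\<close>
  define T where "T x = (\<Sum>c\<in>C - D. A x c *\<^sub>R c)" for x
  have linear_T: "linear T"
    unfolding T_def using A
    by (intro linear_compose_sum ballI linear_compose_scale_right)
       (auto intro!: linearI simp: bilinear_ladd bilinear_lmul scaleR_add_left)
  interpret T: linear T by (rule linear_T)
  have "x = 0" if x: "x \<in> span (E - D)" and Tx: "T x = 0" for x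
  proof -
    have xH: "x \<in> H"
      using x E(2) H by (meson Diff_subset span_minimal subset_iff subset_trans)
    have "A x c = 0" if "c \<in> C - D" for c
      using independentD[OF independent_mono[OF C(3)], of "C - D" "C - D" "A x" c] Tx fin that
      by (auto simp: T_def)
    moreover have "A x d = 0" if "d \<in> D" for d
      using radical xH D(1) that by blast
    ultimately have "A x c = 0" if "c \<in> C" for c
      using that by blast
    then have "A x y = 0" if "y \<in> M" for y
      using linear_eq_0_on_span[OF linear_A(2), of C x y] C(4) that by blast
    then have "x \<in> span D"
      using separates[OF xH] xH D(3) by blast
    then show "x = 0"
      using span_disjoint_subsets_of_independent[OF E(3), of "E - D" D x] x E(1) by blast
  qed
  then have inj: "inj_on T (span (E - D))"
    by (intro inj_onI) (metis T.diff span_diff right_minus_eq)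
  have ind: "independent (T ` (E - D))"
    using linear_independent_injective_image[OF linear_T _ inj] independent_mono[OF E(3)] by blast
  have "T ` (E - D) \<subseteq> span (C - D)"
    unfolding T_def by (auto intro!: span_sum span_scale intro: span_base)
  then have "card (T ` (E - D)) \<le> card (C - D)"
    using independent_span_bound[OF _ ind] fin by blast
  moreover have "card (T ` (E - D)) = card (E - D)"
    using card_image inj_on_subset[OF inj] span_superset by blast
  ultimately have "card (E - D) \<le> card (C - D)"
    by simp
  moreover have "card E = card D + card (E - D)" "card C = card D + card (C - D)"
    using fin E(1) C(1) by (metis card_Diff_subset card_mono finite_subset le_add_diff_inverse)+
  moreover have "card E = dim H" "card C = dim M"
    using basis_card_eq_dim E C by blast+
  ultimately show ?thesis
    by simp
qed

lemma bilinear_form_zero_on_isotropic: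
  fixes A :: "'a::real_vector \<Rightarrow> 'a \<Rightarrow> real"
  assumes A: "bilinear A" "\<And>x y. A x y = A y x"
    and N: "subspace N" "\<And>x. x \<in> N \<Longrightarrow> A x x = 0" and "x \<in> N" "y \<in> N"
  shows "A x y = 0"
proof -
  have "A (x + y) (x + y) = A x x + 2 * A x y + A y y"
    using A(2)[of y x] by (simp add: bilinear_ladd[OF A(1)] bilinear_radd[OF A(1)])
  then show ?thesis
    using assms by (simp add: subspace_add)
qed

text \<open>
  The subspace \<open>M + \<real>x\<close> consists of zeros of \<open>P\<close>: in \<open>A (y + t x) (y + t x)\<close> the square terms vanish
  because \<open>y\<close> and \<open>x\<close> are zeros, the mixed ones by orthogonality.
\<close>

lemma orthogonal_isotropic_in_maximal:
  assumes A: "bilinear A" "\<And>x y. A x y = A y x" "\<And>x. P x = A x x"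
    and M: "P_maximal P M"
    and x: "P x = 0" "\<And>y. y \<in> M \<Longrightarrow> A x y = 0"
  shows "x \<in> M"
proof -
  have subM: "subspace M" and zero: "\<And>y. y \<in> M \<Longrightarrow> A y y = 0"
    and maximal: "\<And>N. subspace N \<Longrightarrow> M \<subseteq> N \<Longrightarrow> \<forall>z\<in>N. P z = 0 \<Longrightarrow> N = M"
    using M A(3) unfolding P_maximal_def by auto
  have "P z = 0" if "z \<in> span (insert x M)" for z
  proof -
    obtain t where "z - t *\<^sub>R x \<in> span M"
      using \<open>z \<in> span (insert x M)\<close> unfolding span_breakdown_eq by blast
    then obtain y where y: "y \<in> M" "z = y + t *\<^sub>R x"
      using subM by (metis diff_add_cancel span_eq_iff)
    then show ?thesis
      using x(1) x(2)[of y] zero[of y] A(2)[of y x]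
      by (simp add: A(3) bilinear_ladd[OF A(1)] bilinear_radd[OF A(1)]
          bilinear_lmul[OF A(1)] bilinear_rmul[OF A(1)])
  qed
  moreover have "insert x M \<subseteq> span (insert x M)"
    by (rule span_superset)
  ultimately show ?thesis
    using maximal[of "span (insert x M)"] subspace_span by blast
qed

theorem theorem4:
  fixes P :: "'a::banach \<Rightarrow> real" and M H :: "'a set" and k m :: nat
  assumes "continuous_quadratic P"
    and "P_maximal P M"
    and "subspace_of_dim M k"
    and "subspace_of_dim H m"
    and "\<forall>x\<in>H. P x = 0"
  shows "m \<le> k"
proof -
  obtain A where A: "bilinear A" "\<And>x y. A x y = A y x" "\<And>x. P x = A x x"
    using assms(1) unfolding continuous_quadratic_def by blast
  obtain F G where F: "finite F" "span F = H" and G: "finite G" "span G = M"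
    using assms(3,4) unfolding subspace_of_dim_def by blast
  have H: "subspace H" and M: "subspace M" and dims: "dim H = m" "dim M = k"
    using assms(3,4) unfolding subspace_of_dim_def by blast+
  have "dim H \<le> dim M"
  proof (rule dim_le_if_pairing_separates[OF A(1) H M F(1) _ G(1)])
    show "A x y = 0" if "x \<in> H" "y \<in> H \<inter> M" for x y
      using bilinear_form_zero_on_isotropic[OF A(1,2) H] assms(5) A(3) that by simp
    show "x \<in> M" if "x \<in> H" "\<And>y. y \<in> M \<Longrightarrow> A x y = 0" for x
      using orthogonal_isotropic_in_maximal[OF A assms(2)] assms(5) that by blast
  qed (use F G in simp_all)
  then show ?thesis
    using dims by simp
qed

end
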